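(* Let $p\ge 1$ and let $q_1,\ldots,q_p$ be the numbers of levels of $p$ categorical predictors. There is a constant $\nu>0$, independent of the subsample, such that for every subsample $X_s$ of size $n$ with information matrix $M_s=Z_s^TZ_s$, $$\lambda_{\min}(M_s)\ \ge\ n\,\nu\,\bigl(1-f(X_s)\bigr),$$ where $\lambda_{\min}(M_s)$ is the smallest eigenvalue of $M_s$ and $$f(X_s)=\sqrt{\sum_{j=1}^{p}\sum_{u=1}^{q_j}q_j^2\left[\frac{1}{q_j}-\frac{n_j(u)}{n}\right]^2+\sum_{j=1}^{p}\sum_{\substack{k=1\\k\ne j}}^{p}\sum_{u=1}^{q_j}\sum_{v=1}^{q_k}q_jq_k\left[\frac{1}{q_jq_k}-\frac{n_{jk}(u,v)}{n}\right]^2}.$$ Therefore, $M_s$ is nonsingular if $f(X_s)<1$.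
   Context: The full data are an $N\times p$ matrix $X=(x_1,\ldots,x_N)^T$, whose row $x_i=(x_{i1},\ldots,x_{ip})^T$ contains the values of $p$ categorical predictors, with $x_{ij}\in\{1,\ldots,q_j\}$. Dummy coding: the $j$th predictor is coded by $q_j-1$ binary dummy variables. The $k$th dummy variable ($1\le k\le q_j-1$) of $x_{ij}$ is $z_{i,jk}=1$ if $x_{ij}=k$ and $z_{i,jk}=0$ otherwise (level $q_j$ is the baseline). The coded row for $x_i$ is $(1,z_{i,11},\ldots,z_{i,1(q_1-1)},\ldots,z_{i,p1},\ldots,z_{i,p(q_p-1)})$, including the leading $1$ for the intercept. $Z$ is the matrix with these $N$ rows. It is assumed that $Z^TZ$ is nonsingular. A subsample $X_s$ of size $n$ (with $n\geq 1$) is an $n\times p$ matrix formed by $n$ of the $N$ rows of $X$. $Z_s$ is the matrix formed by the corresponding $n$ rows of $Z$. $n_j(u)$ is the number of rows of $X_s$ in which the $j$th predictor takes level $u$. $n_{jk}(u,v)$ is the number of rows of $X_s$ in which the $j$th predictor takes level $u$ and the $k$th predictor takes level $v$. *)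

theory Defs
  imports Complex_Main "Jordan_Normal_Form.Spectral_Radius"
begin

text \<open>
  A data matrix of categorical predictors is a \<^typ>\<open>nat mat\<close> with one row per observation.
  Rows and columns are indexed from 0, as usual for this matrix type, so the predictors are
  the indices \<open>j < p\<close>. The levels of predictor \<open>j\<close> are the values \<open>1, \<dots>, q j\<close>.
\<close>

definition categorical_data :: "(nat \<Rightarrow> nat) \<Rightarrow> nat mat \<Rightarrow> bool" where
  "categorical_data q X \<longleftrightarrow> (\<forall>i < dim_row X. \<forall>j < dim_col X. X $$ (i, j) \<in> {1..q j})"

text \<open>
  The columns of the coded matrix after the intercept are labelled by the pairs \<open>(j, k)\<close> of a
  predictor and a non-baseline level \<open>k = 1, \<dots>, q j - 1\<close>, in lexicographic order.
\<close>

definition dummy_labels :: "nat \<Rightarrow> (nat \<Rightarrow> nat) \<Rightarrow> (nat \<times> nat) list" where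
  "dummy_labels p q = concat (map (\<lambda>j. map (\<lambda>k. (j, k)) [1..<q j]) [0..<p])"

definition coded_row :: "(nat \<Rightarrow> nat) \<Rightarrow> nat vec \<Rightarrow> real vec" where
  "coded_row q x =
     vec_of_list (1 # map (\<lambda>(j, k). if x $ j = k then 1 else 0) (dummy_labels (dim_vec x) q))"

definition dummy_coding :: "(nat \<Rightarrow> nat) \<Rightarrow> nat mat \<Rightarrow> real mat" where
  "dummy_coding q X =
     mat_of_rows (1 + length (dummy_labels (dim_col X) q)) (map (coded_row q) (rows X))"

text \<open>
  A subsample is given by the list of the row indices that it selects. Its entries are required
  to be distinct by the predicate \<open>subsample_indices\<close>: no row is drawn twice.
\<close>

definition subsample_indices :: "nat \<Rightarrow> nat \<Rightarrow> nat list \<Rightarrow> bool" where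
  "subsample_indices N n idx \<longleftrightarrow> length idx = n \<and> distinct idx \<and> set idx \<subseteq> {..<N}"

definition select_rows :: "'a mat \<Rightarrow> nat list \<Rightarrow> 'a mat" where
  "select_rows A idx = mat_of_rows (dim_col A) (map (row A) idx)"

definition level_count :: "nat mat \<Rightarrow> nat \<Rightarrow> nat \<Rightarrow> nat" where
  "level_count Xs j u = card {i. i < dim_row Xs \<and> Xs $$ (i, j) = u}"

definition pair_count :: "nat mat \<Rightarrow> nat \<Rightarrow> nat \<Rightarrow> nat \<Rightarrow> nat \<Rightarrow> nat" where
  "pair_count Xs j k u v = card {i. i < dim_row Xs \<and> Xs $$ (i, j) = u \<and> Xs $$ (i, k) = v}"

definition imbalance :: "(nat \<Rightarrow> nat) \<Rightarrow> nat mat \<Rightarrow> real" where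
  "imbalance q Xs =
    (let n = real (dim_row Xs); p = dim_col Xs in
      sqrt ((\<Sum>j<p. \<Sum>u=1..q j.
               (real (q j))\<^sup>2 * (1 / real (q j) - real (level_count Xs j u) / n)\<^sup>2)
          + (\<Sum>j<p. \<Sum>k\<in>{..<p} - {j}. \<Sum>u=1..q j. \<Sum>v=1..q k.
               real (q j) * real (q k) *
                 (1 / (real (q j) * real (q k)) - real (pair_count Xs j k u v) / n)\<^sup>2)))"

text \<open>
  Meaningful for real symmetric matrices of positive dimension, whose real spectrum is
  finite and nonempty and contains all complex eigenvalues.
\<close>

definition lambda_min :: "real mat \<Rightarrow> real" where
  "lambda_min A = Min (spectrum A)"

end

theory Submission
  imports Defs "HOL-Analysis.L2_Norm"
begin

text \<open>
  For a coefficient vector \<open>c\<close> write the fitted value at \<open>x\<close> as \<open>m + (\<Sum>j. h j (x j))\<close> with every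
  \<open>h j\<close> centred over the levels of predictor \<open>j\<close>. Under the uniform distribution on all level
  combinations its second moment is \<open>Q = m\<^sup>2 + (\<Sum>j. (\<Sum>u. (h j u)\<^sup>2) / q j)\<close>, which dominates
  \<open>(c \<bullet> c) / K\<close> for a constant \<open>K\<close> depending only on \<open>q\<close>. The second moment over the subsample is
  \<open>c \<bullet> (Ms c) / n\<close>. It differs from \<open>Q\<close> by a sum of level and pair frequency deviations
  weighted by products of \<open>m\<close> and \<open>h\<close>, so by the Cauchy-Schwarz inequality the difference
  is at most \<open>f Q\<close>. Hence \<open>c \<bullet> (Ms c) \<ge> n (1 - f) (c \<bullet> c) / K\<close> if \<open>f < 1\<close>, and otherwise
  the bound is trivial because \<open>Ms\<close> is positive semidefinite.
\<close>

section \<open>Grouped sums and elementary inequalities\<close>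

lemma sum_by_value:
  fixes F :: "'b \<Rightarrow> real"
  assumes "finite I" "finite L" "\<And>i. i \<in> I \<Longrightarrow> x i \<in> L"
  shows "(\<Sum>i\<in>I. F (x i)) = (\<Sum>u\<in>L. real (card {i \<in> I. x i = u}) * F u)"
proof -
  have "(\<Sum>i\<in>I. F (x i)) = (\<Sum>u\<in>L. \<Sum>i\<in>{i \<in> I. x i = u}. F (x i))"
    using assms by (intro sum.group[symmetric]) auto
  also have "\<dots> = (\<Sum>u\<in>L. real (card {i \<in> I. x i = u}) * F u)"
    by (intro sum.cong) auto
  finally show ?thesis .
qed

lemma sum_by_value_pair:
  fixes F :: "'b \<Rightarrow> 'c \<Rightarrow> real"
  assumes "finite I" "finite L" "finite L'"
    and "\<And>i. i \<in> I \<Longrightarrow> x i \<in> L" "\<And>i. i \<in> I \<Longrightarrow> y i \<in> L'"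
  shows "(\<Sum>i\<in>I. F (x i) (y i)) =
    (\<Sum>u\<in>L. \<Sum>v\<in>L'. real (card {i \<in> I. x i = u \<and> y i = v}) * F u v)"
  using sum_by_value[of I "L \<times> L'" "\<lambda>i. (x i, y i)" "\<lambda>(u, v). F u v"] assms
  by (simp add: sum.cartesian_product split_def prod_eq_iff)

text \<open>The disjoint union of the two index sets turns both sums into one inner product. Level
  terms and pair terms are thus estimated together and appear under a single root, as in
  \<open>imbalance\<close>.\<close>

lemma Cauchy_Schwarz_two_sums:
  fixes a b :: "'i \<Rightarrow> real" and c d :: "'j \<Rightarrow> real"
  assumes "finite A" "finite B"
  shows "(\<Sum>i\<in>A. a i * b i) + (\<Sum>j\<in>B. c j * d j) \<le>
    sqrt ((\<Sum>i\<in>A. (a i)\<^sup>2) + (\<Sum>j\<in>B. (c j)\<^sup>2)) * sqrt ((\<Sum>i\<in>A. (b i)\<^sup>2) + (\<Sum>j\<in>B. (d j)\<^sup>2))"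
proof -
  have "(\<Sum>i\<in>A. a i * b i) + (\<Sum>j\<in>B. c j * d j) =
      (\<Sum>s\<in>A <+> B. case_sum a c s * case_sum b d s)"
    using assms by (simp add: sum.Plus)
  also have "\<dots> \<le> (\<Sum>s\<in>A <+> B. \<bar>case_sum a c s\<bar> * \<bar>case_sum b d s\<bar>)"
    by (intro sum_mono) (simp flip: abs_mult)
  also have "\<dots> \<le> L2_set (case_sum a c) (A <+> B) * L2_set (case_sum b d) (A <+> B)"
    by (rule L2_set_mult_ineq)
  finally show ?thesis
    using assms by (simp add: L2_set_def sum.Plus)
qed

text \<open>
  With \<open>v = m + h\<close>, the left-hand side is the diagonal part of the squared Frobenius norm of the
  matrix with entries \<open>v u * v w - m\<^sup>2\<close>, and the right-hand side is the whole of it. Bounding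
  \<open>(v u)\<^sup>2\<close> instead of \<open>(v u)\<^sup>2 - m\<^sup>2\<close> would cost \<open>m\<^sup>4\<close> for each predictor.
\<close>

lemma sum_squares_diagonal_le:
  fixes h :: "'a \<Rightarrow> real"
  assumes "finite U" "(\<Sum>u\<in>U. h u) = 0"
  defines "S \<equiv> (\<Sum>u\<in>U. (h u)\<^sup>2)"
  shows "(\<Sum>u\<in>U. (2 * m * h u + (h u)\<^sup>2)\<^sup>2) \<le> 2 * m\<^sup>2 * real (card U) * S + S\<^sup>2"
proof -
  define T where "T u w = (m * h u + m * h w + h u * h w)\<^sup>2" for u w
  have "(\<Sum>u\<in>U. (2 * m * h u + (h u)\<^sup>2)\<^sup>2) = (\<Sum>u\<in>U. T u u)"
    unfolding T_def by (intro sum.cong refl) (simp add: power2_eq_square algebra_simps)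
  also have "\<dots> \<le> (\<Sum>u\<in>U. \<Sum>w\<in>U. T u w)"
    using assms(1) by (intro sum_mono member_le_sum) (auto simp: T_def)
  also have "\<dots> = (\<Sum>u\<in>U. m\<^sup>2 * real (card U) * (h u)\<^sup>2 + m\<^sup>2 * S + (h u)\<^sup>2 * S + 2 * m * S * h u)"
  proof (intro sum.cong refl)
    fix u
    \<comment> \<open>The terms linear in \<open>h w\<close> are collected because they vanish in
      the sum over \<open>w\<close>. The last term leaves \<open>2 * m * S * h u\<close>, which
      vanishes in the sum over \<open>u\<close>.\<close>
    have "(\<Sum>w\<in>U. T u w) = (\<Sum>w\<in>U. m\<^sup>2 * (h u)\<^sup>2 + m\<^sup>2 * (h w)\<^sup>2 + (h u)\<^sup>2 * (h w)\<^sup>2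
        + (2 * m\<^sup>2 * h u + 2 * m * (h u)\<^sup>2) * h w + 2 * m * h u * (h w)\<^sup>2)"
      unfolding T_def by (intro sum.cong refl) (simp add: power2_eq_square algebra_simps)
    also have "\<dots> = m\<^sup>2 * real (card U) * (h u)\<^sup>2 + m\<^sup>2 * S + (h u)\<^sup>2 * S + 2 * m * S * h u"
      by (simp add: sum.distrib assms(2) S_def flip: sum_distrib_left)
    finally show "(\<Sum>w\<in>U. T u w) = \<dots>" .
  qed
  also have "\<dots> = 2 * m\<^sup>2 * real (card U) * S + S\<^sup>2"
    by (simp add: sum.distrib assms(2) power2_eq_square[of S] flip: sum_distrib_left sum_distrib_right)
      (simp add: S_def)
  finally show ?thesis .
qed

section \<open>Comparison of the subsample with the uniform design\<close>

lemma additive_model_energy_ge: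
  fixes q :: "nat \<Rightarrow> nat" and x :: "nat \<Rightarrow> nat \<Rightarrow> nat" and h :: "nat \<Rightarrow> nat \<Rightarrow> real" and m :: real
  assumes n: "n \<ge> 1" and q: "\<And>j. j < p \<Longrightarrow> q j \<ge> 1"
    and x: "\<And>i j. i < n \<Longrightarrow> j < p \<Longrightarrow> x i j \<in> {1..q j}"
    and h: "\<And>j. j < p \<Longrightarrow> (\<Sum>u=1..q j. h j u) = 0"
  defines "N \<equiv> \<lambda>j u. real (card {i. i < n \<and> x i j = u})"
    and "NN \<equiv> \<lambda>j k u v. real (card {i. i < n \<and> x i j = u \<and> x i k = v})"
    and "Q \<equiv> m\<^sup>2 + (\<Sum>j<p. (\<Sum>u=1..q j. (h j u)\<^sup>2) / real (q j))"
  defines "f \<equiv> sqrt ((\<Sum>j<p. \<Sum>u=1..q j. (real (q j))\<^sup>2 * (1 / real (q j) - N j u / real n)\<^sup>2)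
      + (\<Sum>j<p. \<Sum>k\<in>{..<p} - {j}. \<Sum>u=1..q j. \<Sum>v=1..q k. real (q j) * real (q k) *
           (1 / (real (q j) * real (q k)) - NN j k u v / real n)\<^sup>2))"
  shows "real n * (1 - f) * Q \<le> (\<Sum>i<n. (m + (\<Sum>j<p. h j (x i j)))\<^sup>2)"
proof -
  \<comment> \<open>\<open>w j\<close> is the share of predictor \<open>j\<close> alone in the
    expanded square. Its linear part vanishes on summing over the levels, so its average over the
    levels is \<open>a j\<close>.\<close>
  define w where "w j u = 2 * m * h j u + (h j u)\<^sup>2" for j u
  define a where "a j = (\<Sum>u=1..q j. (h j u)\<^sup>2) / real (q j)" for j
  have a0: "a j \<ge> 0" for j
    by (simp add: a_def sum_nonneg)
  have qa: "(\<Sum>u=1..q j. (h j u)\<^sup>2) = real (q j) * a j" if "j < p" for j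
    using q[OF that] by (simp add: a_def)
  have sumw: "(\<Sum>u=1..q j. w j u) = real (q j) * a j" if "j < p" for j
    using h[OF that] qa[OF that] by (simp add: w_def sum.distrib flip: sum_distrib_left)

  \<comment> \<open>\<open>R\<close> is the uniform average minus the subsample average of the
    squared fitted value, arranged by the frequency deviations that occur in \<open>f\<close>. The
    target is \<open>R\<close> \<le> \<open>f * Q\<close>.\<close>
  define R where "R = (\<Sum>j<p. \<Sum>u=1..q j. w j u * (1 / real (q j) - N j u / n)) +
    (\<Sum>j<p. \<Sum>k\<in>{..<p} - {j}. \<Sum>u=1..q j. \<Sum>v=1..q k.
       h j u * h k v * (1 / (real (q j) * real (q k)) - NN j k u v / n))"

  have expand: "(\<Sum>i<n. (m + (\<Sum>j<p. h j (x i j)))\<^sup>2) = n * m\<^sup>2 + (\<Sum>j<p. \<Sum>u=1..q j. N j u * w j u) +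
     (\<Sum>j<p. \<Sum>k\<in>{..<p} - {j}. \<Sum>u=1..q j. \<Sum>v=1..q k. NN j k u v * (h j u * h k v))"
  proof -
    have "(m + (\<Sum>j<p. h j (x i j)))\<^sup>2 = m\<^sup>2 + (\<Sum>j<p. w j (x i j)) +
        (\<Sum>j<p. \<Sum>k\<in>{..<p} - {j}. h j (x i j) * h k (x i k))" for i
    proof -
      have "(\<Sum>j<p. h j (x i j))\<^sup>2 = (\<Sum>j<p. \<Sum>k<p. h j (x i j) * h k (x i k))"
        by (simp add: power2_eq_square sum_product)
      also have "\<dots> = (\<Sum>j<p. (h j (x i j))\<^sup>2 + (\<Sum>k\<in>{..<p} - {j}. h j (x i j) * h k (x i k)))"
        by (intro sum.cong refl) (simp add: sum.remove power2_eq_square)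
      finally show ?thesis
        by (simp add: power2_sum w_def sum.distrib sum_distrib_left algebra_simps)
    qed
    hence "(\<Sum>i<n. (m + (\<Sum>j<p. h j (x i j)))\<^sup>2) = n * m\<^sup>2 + (\<Sum>j<p. \<Sum>i<n. w j (x i j)) +
        (\<Sum>i<n. \<Sum>j<p. \<Sum>k\<in>{..<p} - {j}. h j (x i j) * h k (x i k))"
      by (simp add: sum.distrib sum.swap[of "\<lambda>i j. w j (x i j)"])
    also have "(\<Sum>i<n. \<Sum>j<p. \<Sum>k\<in>{..<p} - {j}. h j (x i j) * h k (x i k)) =
        (\<Sum>j<p. \<Sum>k\<in>{..<p} - {j}. \<Sum>i<n. h j (x i j) * h k (x i k))"
      by (simp only: sum.swap[where A = "{..<n}"])
    also have "\<dots> = (\<Sum>j<p. \<Sum>k\<in>{..<p} - {j}. \<Sum>u=1..q j. \<Sum>v=1..q k. NN j k u v * (h j u * h k v))"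
    proof (rule sum.cong[OF refl], rule sum.cong[OF refl])
      fix j k assume "j \<in> {..<p}" "k \<in> {..<p} - {j}"
      with x show "(\<Sum>i<n. h j (x i j) * h k (x i k)) =
          (\<Sum>u=1..q j. \<Sum>v=1..q k. NN j k u v * (h j u * h k v))"
        using sum_by_value_pair[of "{..<n}" "{1..q j}" "{1..q k}" "\<lambda>i. x i j" "\<lambda>i. x i k"
            "\<lambda>u v. h j u * h k v"] by (simp add: NN_def)
    qed
    also have "(\<Sum>j<p. \<Sum>i<n. w j (x i j)) = (\<Sum>j<p. \<Sum>u=1..q j. N j u * w j u)"
    proof (rule sum.cong[OF refl])
      fix j assume "j \<in> {..<p}"
      with x show "(\<Sum>i<n. w j (x i j)) = (\<Sum>u=1..q j. N j u * w j u)"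
        using sum_by_value[of "{..<n}" "{1..q j}" "\<lambda>i. x i j" "w j"] by (simp add: N_def)
    qed
    finally show ?thesis .
  qed

  have "real n * R = n * (\<Sum>j<p. a j) - (\<Sum>j<p. \<Sum>u=1..q j. N j u * w j u) -
     (\<Sum>j<p. \<Sum>k\<in>{..<p} - {j}. \<Sum>u=1..q j. \<Sum>v=1..q k. NN j k u v * (h j u * h k v))"
  proof -
    have 1: "real n * (\<Sum>u=1..q j. w j u * (1 / real (q j) - N j u / n)) =
        n * a j - (\<Sum>u=1..q j. N j u * w j u)" if "j < p" for j
    proof -
      have "real n * (\<Sum>u=1..q j. w j u * (1 / real (q j) - N j u / n)) =
          (\<Sum>u=1..q j. n / real (q j) * w j u - N j u * w j u)"
        unfolding sum_distrib_left using n by (intro sum.cong refl) (simp add: field_simps)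
      also have "\<dots> = n * a j - (\<Sum>u=1..q j. N j u * w j u)"
        unfolding sum_subtractf sum_distrib_left[symmetric] sumw[OF that] using q[OF that] by simp
      finally show ?thesis .
    qed
    \<comment> \<open>The uniform part of a pair term factors into a product of level sums and
      vanishes because \<open>h k\<close> is centred. This is why \<open>Q\<close> has no cross
      terms.\<close>
    have 2: "real n * (\<Sum>u=1..q j. \<Sum>v=1..q k.
        h j u * h k v * (1 / (real (q j) * real (q k)) - NN j k u v / n)) =
        - (\<Sum>u=1..q j. \<Sum>v=1..q k. NN j k u v * (h j u * h k v))" if "j < p" "k < p" for j k
    proof -
      have "real n * (\<Sum>u=1..q j. \<Sum>v=1..q k.
          h j u * h k v * (1 / (real (q j) * real (q k)) - NN j k u v / n)) =
          (\<Sum>u=1..q j. \<Sum>v=1..q k. n / (real (q j) * real (q k)) * h j u * h k v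
            - NN j k u v * (h j u * h k v))"
        unfolding sum_distrib_left using n by (intro sum.cong refl) (simp add: field_simps)
      also have "\<dots> = - (\<Sum>u=1..q j. \<Sum>v=1..q k. NN j k u v * (h j u * h k v))"
        unfolding sum_subtractf sum_distrib_left[symmetric] h[OF that(2)] by simp
      finally show ?thesis .
    qed
    have "real n * R = (\<Sum>j<p. real n * (\<Sum>u=1..q j. w j u * (1 / real (q j) - N j u / n))) +
      (\<Sum>j<p. \<Sum>k\<in>{..<p} - {j}. real n * (\<Sum>u=1..q j. \<Sum>v=1..q k.
       h j u * h k v * (1 / (real (q j) * real (q k)) - NN j k u v / n)))"
      unfolding R_def by (simp only: distrib_left sum_distrib_left[of "real n" _ "{..<p}"]
          sum_distrib_left[of "real n" _ "{..<p} - {_}"])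
    also have "\<dots> = (\<Sum>j<p. n * a j - (\<Sum>u=1..q j. N j u * w j u)) +
      (\<Sum>j<p. \<Sum>k\<in>{..<p} - {j}. - (\<Sum>u=1..q j. \<Sum>v=1..q k. NN j k u v * (h j u * h k v)))"
      by (intro arg_cong2[of _ _ _ _ "(+)"] sum.cong refl 1 2) auto
    finally show ?thesis
      by (simp add: sum_subtractf sum_negf sum_distrib_left)
  qed
  hence energy: "(\<Sum>i<n. (m + (\<Sum>j<p. h j (x i j)))\<^sup>2) = n * Q - n * R"
    unfolding expand Q_def a_def by (simp add: algebra_simps)

  \<comment> \<open>The nested sums are flattened over \<open>A\<close> and \<open>B\<close> so that
    each family has a single index for Cauchy-Schwarz.\<close>
  define A where "A = (SIGMA j:{..<p}. {1..q j})"
  define B where "B = (SIGMA j:{..<p}. SIGMA k:{..<p} - {j}. {1..q j} \<times> {1..q k})"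
  have toA: "(\<Sum>j<p. \<Sum>u=1..q j. F j u) = (\<Sum>(j, u)\<in>A. F j u)" for F :: "nat \<Rightarrow> nat \<Rightarrow> real"
    unfolding A_def by (rule sum.Sigma) auto
  have toB: "(\<Sum>j<p. \<Sum>k\<in>{..<p} - {j}. \<Sum>u=1..q j. \<Sum>v=1..q k. F j k u v) = (\<Sum>(j, k, u, v)\<in>B. F j k u v)"
    for F :: "nat \<Rightarrow> nat \<Rightarrow> nat \<Rightarrow> nat \<Rightarrow> real"
    unfolding B_def by (simp add: sum.Sigma sum.cartesian_product split_def)
  have fin: "finite A" "finite B"
    by (auto simp: A_def B_def)

  \<comment> \<open>The weights \<open>q j\<close> and \<open>sqrt (q j * q k)\<close> are moved
    onto the deviations so that the squares of the first factors sum to the radicand of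
    \<open>f\<close>; the inverse weights stay with the model terms.\<close>
  have "R = (\<Sum>(j, u)\<in>A. (real (q j) * (1 / real (q j) - N j u / n)) * (w j u / real (q j))) +
    (\<Sum>(j, k, u, v)\<in>B. (sqrt (real (q j) * real (q k)) * (1 / (real (q j) * real (q k)) - NN j k u v / n))
       * (h j u * h k v / sqrt (real (q j) * real (q k))))"
    unfolding R_def toA toB using q
    by (intro arg_cong2[of _ _ _ _ "(+)"] sum.cong refl) (fastforce simp: A_def B_def)+
  also have "\<dots> \<le> sqrt ((\<Sum>(j, u)\<in>A. (real (q j) * (1 / real (q j) - N j u / n))\<^sup>2) +
      (\<Sum>(j, k, u, v)\<in>B. (sqrt (real (q j) * real (q k)) * (1 / (real (q j) * real (q k)) - NN j k u v / n))\<^sup>2)) *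
     sqrt ((\<Sum>(j, u)\<in>A. (w j u / real (q j))\<^sup>2) +
      (\<Sum>(j, k, u, v)\<in>B. (h j u * h k v / sqrt (real (q j) * real (q k)))\<^sup>2))"
    using Cauchy_Schwarz_two_sums[OF fin, of
        "\<lambda>(j, u). real (q j) * (1 / real (q j) - N j u / n)" "\<lambda>(j, u). w j u / real (q j)"
        "\<lambda>(j, k, u, v). sqrt (real (q j) * real (q k)) * (1 / (real (q j) * real (q k)) - NN j k u v / n)"
        "\<lambda>(j, k, u, v). h j u * h k v / sqrt (real (q j) * real (q k))"]
    by (simp add: split_def)
  also have "(\<Sum>(j, u)\<in>A. (real (q j) * (1 / real (q j) - N j u / n))\<^sup>2) +
      (\<Sum>(j, k, u, v)\<in>B. (sqrt (real (q j) * real (q k)) * (1 / (real (q j) * real (q k)) - NN j k u v / n))\<^sup>2)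
     = (\<Sum>j<p. \<Sum>u=1..q j. (real (q j))\<^sup>2 * (1 / real (q j) - N j u / real n)\<^sup>2)
      + (\<Sum>j<p. \<Sum>k\<in>{..<p} - {j}. \<Sum>u=1..q j. \<Sum>v=1..q k. real (q j) * real (q k) *
           (1 / (real (q j) * real (q k)) - NN j k u v / real n)\<^sup>2)"
    unfolding toA toB by (simp add: power_mult_distrib)
  also have "sqrt \<dots> = f"
    by (simp add: f_def)
  also have "(\<Sum>(j, u)\<in>A. (w j u / real (q j))\<^sup>2) = (\<Sum>j<p. (\<Sum>u=1..q j. (w j u)\<^sup>2) / (real (q j))\<^sup>2)"
    unfolding toA[symmetric] by (simp add: power_divide sum_divide_distrib)
  also have "(\<Sum>(j, k, u, v)\<in>B. (h j u * h k v / sqrt (real (q j) * real (q k)))\<^sup>2) =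
      (\<Sum>j<p. \<Sum>k\<in>{..<p} - {j}. a j * a k)"
    unfolding toB[symmetric] a_def
    by (simp add: power_divide power_mult_distrib sum_product sum_divide_distrib)
  \<comment> \<open>The second radicand is at most \<open>Q\<^sup>2\<close> minus the fourth power
    of \<open>m\<close>: the diagonal estimate supplies the mixed terms and the squares of
    \<open>a j\<close>, and the pair terms supply the products \<open>a j * a k\<close>.\<close>
  also have "f * sqrt ((\<Sum>j<p. (\<Sum>u=1..q j. (w j u)\<^sup>2) / (real (q j))\<^sup>2) + (\<Sum>j<p. \<Sum>k\<in>{..<p} - {j}. a j * a k)) \<le> f * Q"
  proof (intro mult_left_mono real_le_lsqrt)
    have "(\<Sum>j<p. (\<Sum>u=1..q j. (w j u)\<^sup>2) / (real (q j))\<^sup>2) \<le> (\<Sum>j<p. 2 * m\<^sup>2 * a j + (a j)\<^sup>2)"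
    proof (intro sum_mono)
      fix j assume "j \<in> {..<p}"
      hence j: "j < p" by simp
      \<comment> \<open>In the diagonal estimate \<open>card U\<close> is \<open>q j\<close> and
        \<open>S\<close> is \<open>q j * a j\<close>, so the square of \<open>q j\<close> factors
        out and cancels the denominator.\<close>
      have "(\<Sum>u=1..q j. (w j u)\<^sup>2) \<le> (2 * m\<^sup>2 * a j + (a j)\<^sup>2) * (real (q j))\<^sup>2"
        using sum_squares_diagonal_le[OF _ h[OF j], of m] unfolding w_def qa[OF j]
        by (simp add: power_mult_distrib) (simp add: power2_eq_square algebra_simps)
      thus "(\<Sum>u=1..q j. (w j u)\<^sup>2) / (real (q j))\<^sup>2 \<le> 2 * m\<^sup>2 * a j + (a j)\<^sup>2"
        using q[OF j] by (simp add: divide_le_eq)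
    qed
    moreover have "(\<Sum>j<p. 2 * m\<^sup>2 * a j + (a j)\<^sup>2) + (\<Sum>j<p. \<Sum>k\<in>{..<p} - {j}. a j * a k) + (m\<^sup>2)\<^sup>2 = Q\<^sup>2"
    proof -
      have "(\<Sum>j<p. a j)\<^sup>2 = (\<Sum>j<p. \<Sum>k<p. a j * a k)"
        by (simp add: power2_eq_square sum_product)
      also have "\<dots> = (\<Sum>j<p. (a j)\<^sup>2 + (\<Sum>k\<in>{..<p} - {j}. a j * a k))"
        by (intro sum.cong refl) (simp add: sum.remove power2_eq_square)
      finally show ?thesis
        unfolding Q_def a_def[symmetric] by (simp add: power2_sum sum.distrib sum_distrib_left)
    qed
    ultimately show "(\<Sum>j<p. (\<Sum>u=1..q j. (w j u)\<^sup>2) / (real (q j))\<^sup>2) +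
        (\<Sum>j<p. \<Sum>k\<in>{..<p} - {j}. a j * a k) \<le> Q\<^sup>2"
      using zero_le_power2[of "m\<^sup>2"] by linarith
    show "0 \<le> Q"
      unfolding Q_def a_def[symmetric] by (simp add: a0 sum_nonneg)
    show "0 \<le> f"
      unfolding f_def by (intro real_sqrt_ge_zero add_nonneg_nonneg sum_nonneg) auto
  qed
  finally have "real n * R \<le> real n * (f * Q)"
    by (simp add: mult_left_mono)
  thus ?thesis
    unfolding energy by (simp add: algebra_simps)
qed

section \<open>Coefficients controlled by the uniform second moment\<close>

text \<open>At the baseline level the coefficient is 0, so the deviation there is minus the mean
  \<open>\<mu> j\<close>, and the means are controlled by the centred part. The intercept and the
  other coefficients then follow by the triangle inequality. The factor involves only
  \<open>p\<close> and \<open>q\<close>, which makes the final constant independent of the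
  subsample.\<close>

lemma dummy_coefficients_le_energy:
  fixes q :: "nat \<Rightarrow> nat" and b :: "nat \<Rightarrow> nat \<Rightarrow> real" and c :: real
  assumes q: "\<And>j. j < p \<Longrightarrow> q j \<ge> 1" and b: "\<And>j. j < p \<Longrightarrow> b j (q j) = 0"
  defines "\<mu> \<equiv> \<lambda>j. (\<Sum>u=1..q j. b j u) / real (q j)"
  defines "Q \<equiv> (c + (\<Sum>j<p. \<mu> j))\<^sup>2 + (\<Sum>j<p. (\<Sum>u=1..q j. (b j u - \<mu> j)\<^sup>2) / real (q j))"
  shows "c\<^sup>2 + (\<Sum>j<p. \<Sum>u\<in>{1..<q j}. (b j u)\<^sup>2) \<le>
    ((1 + (\<Sum>j<p. real (q j)))\<^sup>2 + 4 * (\<Sum>j<p. real (q j) ^ 3)) * Q"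
proof -
  define s where "s = sqrt Q"
  have Q0: "Q \<ge> 0"
    unfolding Q_def by (intro add_nonneg_nonneg sum_nonneg divide_nonneg_nonneg) auto
  hence s: "s \<ge> 0" "s\<^sup>2 = Q"
    by (simp_all add: s_def)
  have m: "\<bar>c + (\<Sum>j<p. \<mu> j)\<bar> \<le> s"
    unfolding s_def by (rule real_le_rsqrt) (simp add: Q_def sum_nonneg)
  \<comment> \<open>The natural bound has the root of \<open>q j\<close> as its factor; since
    \<open>q j\<close> is at least 1 it is weakened to \<open>q j\<close>, which keeps the constants
    rational.\<close>
  have dev: "\<bar>b j u - \<mu> j\<bar> \<le> real (q j) * s" if j: "j < p" and u: "u \<in> {1..q j}" for j u
  proof -
    have "(b j u - \<mu> j)\<^sup>2 \<le> (\<Sum>u=1..q j. (b j u - \<mu> j)\<^sup>2)"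
      using u by (intro member_le_sum) auto
    hence "(b j u - \<mu> j)\<^sup>2 / real (q j) \<le> (\<Sum>u=1..q j. (b j u - \<mu> j)\<^sup>2) / real (q j)"
      by (rule divide_right_mono) simp
    also have "\<dots> \<le> (\<Sum>j<p. (\<Sum>u=1..q j. (b j u - \<mu> j)\<^sup>2) / real (q j))"
      using j by (intro member_le_sum[of j]) (auto simp: sum_nonneg)
    also have "\<dots> \<le> s\<^sup>2"
      unfolding s by (simp add: Q_def)
    finally have "(b j u - \<mu> j)\<^sup>2 \<le> s\<^sup>2 * real (q j)"
      using q[OF j] by (simp add: divide_le_eq)
    also have "\<dots> \<le> s\<^sup>2 * (real (q j))\<^sup>2"
      using q[OF j] by (intro mult_left_mono self_le_power) auto
    also have "\<dots> = (real (q j) * s)\<^sup>2"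
      by (simp add: power_mult_distrib mult.commute)
    finally show ?thesis
      using s(1) by (simp flip: abs_le_square_iff add: abs_mult)
  qed
  have \<mu>: "\<bar>\<mu> j\<bar> \<le> real (q j) * s" if "j < p" for j
    using dev[OF that, of "q j"] q[OF that] b[OF that] by simp
  have "\<bar>c\<bar> \<le> \<bar>c + (\<Sum>j<p. \<mu> j)\<bar> + (\<Sum>j<p. \<bar>\<mu> j\<bar>)"
    using sum_abs[of \<mu> "{..<p}"] by linarith
  also have "\<dots> \<le> s + (\<Sum>j<p. real (q j) * s)"
    using \<mu> m by (intro add_mono sum_mono) auto
  also have "\<dots> = (1 + (\<Sum>j<p. real (q j))) * s"
    by (simp add: distrib_right sum_distrib_right)
  finally have "\<bar>c\<bar>\<^sup>2 \<le> ((1 + (\<Sum>j<p. real (q j))) * s)\<^sup>2"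
    by (rule power_mono) simp
  hence 1: "c\<^sup>2 \<le> (1 + (\<Sum>j<p. real (q j)))\<^sup>2 * Q"
    by (simp add: power_mult_distrib s)
  \<comment> \<open>Each coefficient is at most \<open>2 * q j * s\<close> in absolute value, half
    from its deviation and half from the mean. Counting at most \<open>q j\<close> of them yields
    the cube.\<close>
  have "(\<Sum>u\<in>{1..<q j}. (b j u)\<^sup>2) \<le> 4 * real (q j) ^ 3 * Q" if j: "j < p" for j
  proof -
    have "(b j u)\<^sup>2 \<le> 4 * (real (q j))\<^sup>2 * Q" if u: "u \<in> {1..<q j}" for u
    proof -
      have "\<bar>b j u\<bar> \<le> 2 * real (q j) * s"
        using dev[OF j, of u] \<mu>[OF j] u by auto
      hence "\<bar>b j u\<bar>\<^sup>2 \<le> (2 * real (q j) * s)\<^sup>2"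
        by (rule power_mono) simp
      thus ?thesis by (simp add: power_mult_distrib s)
    qed
    hence "(\<Sum>u\<in>{1..<q j}. (b j u)\<^sup>2) \<le> (\<Sum>u\<in>{1..<q j}. 4 * (real (q j))\<^sup>2 * Q)"
      by (rule sum_mono)
    also have "\<dots> \<le> real (q j) * (4 * (real (q j))\<^sup>2 * Q)"
      using Q0 by (simp add: mult_right_mono)
    finally show ?thesis by (simp add: power3_eq_cube power2_eq_square algebra_simps)
  qed
  hence "(\<Sum>j<p. \<Sum>u\<in>{1..<q j}. (b j u)\<^sup>2) \<le> (\<Sum>j<p. 4 * real (q j) ^ 3 * Q)"
    by (intro sum_mono) auto
  also have "\<dots> = 4 * (\<Sum>j<p. real (q j) ^ 3) * Q"
    by (simp add: sum_distrib_left sum_distrib_right)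
  finally show ?thesis
    using 1 by (simp add: distrib_right)
qed

section \<open>Real symmetric matrices and nonsingularity\<close>

lemma real_scalar_prod_self_pos:
  fixes v :: "real vec"
  assumes "v \<in> carrier_vec n" "v \<noteq> 0\<^sub>v n"
  shows "v \<bullet> v > 0"
proof -
  obtain i where "i < n" "v $ i \<noteq> 0"
    using assms by (metis eq_vecI carrier_vecD index_zero_vec)
  thus ?thesis
    using assms(1) unfolding scalar_prod_def by (intro sum_pos2[of _ i]) (auto simp: zero_less_mult_iff)
qed

text \<open>Split a complex eigenvector into real and imaginary parts \<open>a\<close> and
  \<open>b\<close>. Symmetry forces \<open>Im e * (a \<bullet> a + b \<bullet> b) = 0\<close>, so
  \<open>e\<close> is real, and whichever of \<open>a\<close> and \<open>b\<close> is nonzero is a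
  real eigenvector. Nonemptiness gives meaning to the \<open>Min\<close> in
  \<open>lambda_min\<close>.\<close>

lemma symmetric_real_spectrum_nonempty:
  fixes A :: "real mat"
  assumes A: "A \<in> carrier_mat n n" and sym: "transpose_mat A = A" and n: "n > 0"
  shows "spectrum A \<noteq> {}"
proof -
  let ?C = "map_mat complex_of_real A"
  obtain e v where v: "v \<in> carrier_vec n" "v \<noteq> 0\<^sub>v n" "?C *\<^sub>v v = e \<cdot>\<^sub>v v"
    using spectrum_non_empty[of ?C n] A n
    by (auto simp: spectrum_def eigenvalue_def eigenvector_def)
  define a b where "a = map_vec Re v" and "b = map_vec Im v"
  have ab: "a \<in> carrier_vec n" "b \<in> carrier_vec n"
    using v(1) by (auto simp: a_def b_def)
  have comp: "(\<Sum>j = 0..<n. complex_of_real (A $$ (i, j)) * v $ j) = e * v $ i" if "i < n" for i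
    using arg_cong[OF v(3), of "\<lambda>w. w $ i"] A v(1) that by (simp add: scalar_prod_def)
  have Aa: "A *\<^sub>v a = Re e \<cdot>\<^sub>v a - Im e \<cdot>\<^sub>v b"
  proof (intro eq_vecI)
    fix i assume "i < dim_vec (Re e \<cdot>\<^sub>v a - Im e \<cdot>\<^sub>v b)"
    hence i: "i < n" using ab by simp
    show "(A *\<^sub>v a) $ i = (Re e \<cdot>\<^sub>v a - Im e \<cdot>\<^sub>v b) $ i"
      using arg_cong[OF comp[OF i], of Re] A v(1) i by (simp add: scalar_prod_def a_def b_def)
  qed (use A ab in auto)
  have Ab: "A *\<^sub>v b = Re e \<cdot>\<^sub>v b + Im e \<cdot>\<^sub>v a"
  proof (intro eq_vecI)
    fix i assume "i < dim_vec (Re e \<cdot>\<^sub>v b + Im e \<cdot>\<^sub>v a)"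
    hence i: "i < n" using ab by simp
    show "(A *\<^sub>v b) $ i = (Re e \<cdot>\<^sub>v b + Im e \<cdot>\<^sub>v a) $ i"
      using arg_cong[OF comp[OF i], of Im] A v(1) i by (simp add: scalar_prod_def a_def b_def)
  qed (use A ab in auto)
  have nz: "a \<noteq> 0\<^sub>v n \<or> b \<noteq> 0\<^sub>v n"
  proof (rule ccontr)
    assume *: "\<not> ?thesis"
    have "v $ i = 0" if "i < n" for i
    proof -
      have "a $ i = 0" "b $ i = 0" using * that by auto
      thus ?thesis using v(1) that by (simp add: a_def b_def complex_eq_iff)
    qed
    hence "v = 0\<^sub>v n" using v(1) by (intro eq_vecI) auto
    thus False using v(2) by simp
  qed
  have "(A *\<^sub>v a) \<bullet> b = a \<bullet> (A *\<^sub>v b)"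
    using transpose_vec_mult_scalar[OF A ab(2,1)] sym by simp
  hence "Im e * (a \<bullet> a + b \<bullet> b) = 0"
    unfolding Aa Ab using ab
    by (simp add: minus_scalar_prod_distrib[of _ n] scalar_prod_add_distrib[of _ n] algebra_simps)
  moreover have "a \<bullet> a + b \<bullet> b > 0"
  proof -
    have "w \<bullet> w \<ge> 0" for w :: "real vec"
      by (simp add: scalar_prod_def sum_nonneg)
    thus ?thesis
      using nz real_scalar_prod_self_pos[OF ab(1)] real_scalar_prod_self_pos[OF ab(2)]
      by (auto simp: add_pos_nonneg add_nonneg_pos)
  qed
  ultimately have "Im e = 0" by simp
  hence "A *\<^sub>v a = Re e \<cdot>\<^sub>v a" "A *\<^sub>v b = Re e \<cdot>\<^sub>v b"
    unfolding Aa Ab using ab by (auto intro!: eq_vecI)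
  hence "eigenvalue A (Re e)"
    using nz ab A unfolding eigenvalue_def eigenvector_def by auto
  thus ?thesis
    by (auto simp: spectrum_def)
qed

text \<open>Testing the form at an eigenvector bounds its eigenvalue below. The real spectrum is
  finite and nonempty, so its minimum is one of these eigenvalues.\<close>

lemma lambda_min_ge:
  fixes A :: "real mat"
  assumes A: "A \<in> carrier_mat n n" "transpose_mat A = A" "n > 0"
    and ge: "\<And>v. v \<in> carrier_vec n \<Longrightarrow> v \<bullet> (A *\<^sub>v v) \<ge> \<kappa> * (v \<bullet> v)"
  shows "lambda_min A \<ge> \<kappa>"
proof -
  have "\<kappa> \<le> e" if e: "e \<in> spectrum A" for e
  proof -
    obtain v where v: "v \<in> carrier_vec n" "v \<noteq> 0\<^sub>v n" "A *\<^sub>v v = e \<cdot>\<^sub>v v"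
      using e A(1) by (auto simp: spectrum_def eigenvalue_def eigenvector_def)
    have "\<kappa> * (v \<bullet> v) \<le> e * (v \<bullet> v)"
      using ge[OF v(1)] v(1) by (simp add: v(3))
    thus ?thesis
      using real_scalar_prod_self_pos[OF v(1,2)] by simp
  qed
  thus ?thesis
    using card_finite_spectrum(1)[OF A(1)] symmetric_real_spectrum_nonempty[OF A]
    by (simp add: lambda_min_def)
qed

lemma invertible_mat_if_trivial_kernel:
  fixes A :: "'a :: field mat"
  assumes A: "A \<in> carrier_mat n n"
    and ker: "\<And>v. v \<in> carrier_vec n \<Longrightarrow> A *\<^sub>v v = 0\<^sub>v n \<Longrightarrow> v = 0\<^sub>v n"
  shows "invertible_mat A"
proof -
  have "det A \<noteq> 0"
    using ker det_0_iff_vec_prod_zero_field[OF A] by blast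
  from det_non_zero_imp_unit[OF A this, of "()"] obtain B
    where "B \<in> carrier_mat n n" "B * A = 1\<^sub>m n" "A * B = 1\<^sub>m n"
    by (auto simp: Units_def ring_mat_simps)
  thus ?thesis
    using A by (auto simp: invertible_mat_def inverts_mat_def square_mat.simps)
qed

section \<open>Dummy coding as an additive model\<close>

lemma set_dummy_labels: "set (dummy_labels p q) = (SIGMA j:{..<p}. {1..<q j})"
  by (auto simp: dummy_labels_def)

lemma distinct_dummy_labels: "distinct (dummy_labels p q)"
proof (induction p)
  case (Suc p)
  have "distinct (map (\<lambda>k. (p, k)) [1..<q p])"
    by (simp add: distinct_map inj_on_def)
  moreover have "dummy_labels (Suc p) q = dummy_labels p q @ map (\<lambda>k. (p, k)) [1..<q p]"
    by (simp add: dummy_labels_def)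
  ultimately show ?case
    using Suc by (auto simp: set_dummy_labels)
qed (simp add: dummy_labels_def)

text \<open>Distinct labels put column positions in bijection with pairs of a predictor and a
  non-baseline level, so column sums become double sums.\<close>

lemma sum_dummy_labels:
  fixes p q and F :: "nat \<Rightarrow> nat \<Rightarrow> real"
  defines "L \<equiv> dummy_labels p q"
  shows "(\<Sum>l<length L. F (fst (L ! l)) (snd (L ! l))) = (\<Sum>j<p. \<Sum>u\<in>{1..<q j}. F j u)"
proof -
  have "(\<Sum>l<length L. case L ! l of (j, u) \<Rightarrow> F j u) = (\<Sum>(j, u)\<in>set L. F j u)"
    by (rule sum.reindex_bij_betw) (simp add: L_def bij_betw_nth distinct_dummy_labels)
  thus ?thesis
    by (simp add: L_def set_dummy_labels sum.Sigma split_def)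
qed

lemma coded_row_carrier:
  "x \<in> carrier_vec p \<Longrightarrow> coded_row q x \<in> carrier_vec (1 + length (dummy_labels p q))"
  unfolding carrier_vec_def by (simp add: coded_row_def)

text \<open>Extending the coefficients by 0 to the baseline levels makes the fitted value a sum of
  one function per predictor, to which the two estimates above apply.\<close>

lemma dummy_coefficients:
  fixes c :: "real vec"
  assumes c: "c \<in> carrier_vec (1 + length (dummy_labels p q))"
  obtains b :: "nat \<Rightarrow> nat \<Rightarrow> real" where
    "\<And>j. b j (q j) = 0"
    "c \<bullet> c = (c $ 0)\<^sup>2 + (\<Sum>j<p. \<Sum>u\<in>{1..<q j}. (b j u)\<^sup>2)"
    "\<And>x. x \<in> carrier_vec p \<Longrightarrow> (\<And>j. j < p \<Longrightarrow> x $ j \<in> {1..q j}) \<Longrightarrow>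
       coded_row q x \<bullet> c = c $ 0 + (\<Sum>j<p. b j (x $ j))"
proof -
  define L where "L = dummy_labels p q"
  \<comment> \<open>At most one position carries a given label, so the sum picks out its
    coefficient. For the baseline level no position qualifies and the empty sum gives 0.\<close>
  define b where "b j u = (\<Sum>l | l < length L \<and> L ! l = (j, u). c $ Suc l)" for j u
  have dimc: "dim_vec c = Suc (length L)"
    using c by (simp add: L_def)
  have b_label: "b (fst (L ! l)) (snd (L ! l)) = c $ Suc l" if "l < length L" for l
  proof -
    have "{l'. l' < length L \<and> L ! l' = L ! l} = {l}"
      using that by (auto simp: L_def distinct_dummy_labels nth_eq_iff_index_eq)
    thus ?thesis by (simp add: b_def)
  qed
  have b_base: "b j (q j) = 0" for j
  proof -
    have "(j, q j) \<notin> set L" by (simp add: L_def set_dummy_labels)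
    hence "{l. l < length L \<and> L ! l = (j, q j)} = {}" by (metis (mono_tags, lifting) Collect_empty_eq nth_mem)
    thus ?thesis by (simp only: b_def sum.empty)
  qed
  have norm: "c \<bullet> c = (c $ 0)\<^sup>2 + (\<Sum>j<p. \<Sum>u\<in>{1..<q j}. (b j u)\<^sup>2)"
  proof -
    \<comment> \<open>Entry 0 belongs to the intercept, so label \<open>l\<close> sits at entry
      \<open>Suc l\<close>.\<close>
    have "c \<bullet> c = (c $ 0)\<^sup>2 + (\<Sum>l<length L. (c $ Suc l)\<^sup>2)"
      unfolding scalar_prod_def dimc atLeast0LessThan
      by (subst sum.lessThan_Suc_shift) (simp add: power2_eq_square)
    also have "(\<Sum>l<length L. (c $ Suc l)\<^sup>2) = (\<Sum>l<length L. (b (fst (L ! l)) (snd (L ! l)))\<^sup>2)"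
      by (simp add: b_label)
    finally show ?thesis
      unfolding L_def by (simp add: sum_dummy_labels[of "\<lambda>j u. (b j u)\<^sup>2"])
  qed
  have row: "coded_row q x \<bullet> c = c $ 0 + (\<Sum>j<p. b j (x $ j))"
    if x: "x \<in> carrier_vec p" and lev: "\<And>j. j < p \<Longrightarrow> x $ j \<in> {1..q j}" for x
  proof -
    have "coded_row q x \<bullet> c = c $ 0 +
        (\<Sum>l<length L. (if x $ fst (L ! l) = snd (L ! l) then 1 else 0) * c $ Suc l)"
      unfolding scalar_prod_def dimc atLeast0LessThan
      using x by (subst sum.lessThan_Suc_shift) (simp add: coded_row_def vec_of_list_index L_def split_def
          del: vec_of_list_Cons vec_of_list_map)
    also have "(\<Sum>l<length L. (if x $ fst (L ! l) = snd (L ! l) then 1 else 0) * c $ Suc l) =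
        (\<Sum>l<length L. (\<lambda>j u. if x $ j = u then b j u else 0) (fst (L ! l)) (snd (L ! l)))"
      by (intro sum.cong refl) (simp add: b_label)
    also have "\<dots> = (\<Sum>j<p. \<Sum>u\<in>{1..<q j}. if x $ j = u then b j u else 0)"
      unfolding L_def by (rule sum_dummy_labels)
    also have "\<dots> = (\<Sum>j<p. b j (x $ j))"
    \<comment> \<open>If \<open>x $ j\<close> is the baseline level, all indicators vanish, in
      agreement with \<open>b j (q j) = 0\<close>; otherwise exactly one term survives.\<close>
    proof (rule sum.cong[OF refl])
      fix j assume "j \<in> {..<p}"
      with lev[of j] show "(\<Sum>u\<in>{1..<q j}. if x $ j = u then b j u else 0) = b j (x $ j)"
        using b_base[of j] by (cases "x $ j = q j") auto
    qed
    finally show ?thesis .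
  qed
  show thesis
    using that[of b] b_base norm row by blast
qed

section \<open>Lower bound for the information matrix\<close>

lemma information_matrix_form_ge:
  fixes X :: "nat mat" and c :: "real vec"
  assumes X: "X \<in> carrier_mat N p" "categorical_data q X"
    and q: "\<And>j. j < p \<Longrightarrow> q j \<ge> 1"
    and idx: "set idx \<subseteq> {..<N}" "idx \<noteq> []"
    and c: "c \<in> carrier_vec (1 + length (dummy_labels p q))"
  defines "Zs \<equiv> select_rows (dummy_coding q X) idx"
    and "K \<equiv> (1 + (\<Sum>j<p. real (q j)))\<^sup>2 + 4 * (\<Sum>j<p. real (q j) ^ 3)"
  shows "c \<bullet> ((transpose_mat Zs * Zs) *\<^sub>v c) \<ge>
    real (length idx) * (1 / K) * (1 - imbalance q (select_rows X idx)) * (c \<bullet> c)"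
proof -
  define n where "n = length idx"
  define Xs where "Xs = select_rows X idx"
  let ?D = "1 + length (dummy_labels p q)"
  have n: "n \<ge> 1"
    using idx(2) by (cases idx) (auto simp: n_def)
  have idx_less: "idx ! i < N" if "i < n" for i
    using idx(1) that by (simp add: n_def subset_iff)
  have dimX: "dim_row X = N" "dim_col X = p"
    using X(1) by auto
  have Xs: "Xs \<in> carrier_mat n p"
    unfolding carrier_mat_def by (simp add: Xs_def select_rows_def n_def dimX)
  have Xs_entry: "Xs $$ (i, j) = X $$ (idx ! i, j)" if "i < n" "j < p" for i j
    using that idx_less[OF that(1)] by (simp add: Xs_def select_rows_def n_def dimX mat_of_rows_index)
  have levels: "Xs $$ (i, j) \<in> {1..q j}" if "i < n" "j < p" for i j
    using X(2) that idx_less[OF that(1)] by (simp add: Xs_entry categorical_data_def dimX)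
  have Zs: "Zs \<in> carrier_mat n ?D"
    unfolding carrier_mat_def by (simp add: Zs_def select_rows_def dummy_coding_def n_def dimX)
  \<comment> \<open>Coding acts row by row and therefore commutes with row selection. The form
    depends on the subsample through \<open>Xs\<close> alone.\<close>
  have row_Zs: "row Zs i = coded_row q (row Xs i)" if i: "i < n" for i
  proof -
    have "row Zs i = row (dummy_coding q X) (idx ! i)"
      using i X(1) idx_less[OF i] unfolding Zs_def select_rows_def
      by (subst mat_of_rows_row) (auto simp: n_def dummy_coding_def intro!: carrier_vecI)
    also have "\<dots> = coded_row q (row X (idx ! i))"
      using X(1) idx_less[OF i] coded_row_carrier[of "row X (idx ! i)" p q] unfolding dummy_coding_def
      by (subst mat_of_rows_row) (auto simp: rows_def)
    also have "row X (idx ! i) = row Xs i"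
      using X(1) i idx_less[OF i] unfolding Xs_def select_rows_def
      by (subst mat_of_rows_row) (auto simp: n_def)
    finally show ?thesis .
  qed
  obtain b :: "nat \<Rightarrow> nat \<Rightarrow> real" where b:
    "\<And>j. b j (q j) = 0"
    "c \<bullet> c = (c $ 0)\<^sup>2 + (\<Sum>j<p. \<Sum>u\<in>{1..<q j}. (b j u)\<^sup>2)"
    "\<And>x. x \<in> carrier_vec p \<Longrightarrow> (\<And>j. j < p \<Longrightarrow> x $ j \<in> {1..q j}) \<Longrightarrow>
       coded_row q x \<bullet> c = c $ 0 + (\<Sum>j<p. b j (x $ j))"
    using dummy_coefficients[OF c] by blast
  \<comment> \<open>Moving the level means into the intercept leaves every fitted value unchanged
    and makes each \<open>h j\<close> centred.\<close>
  define \<mu> where "\<mu> j = (\<Sum>u=1..q j. b j u) / real (q j)" for j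
  define m where "m = c $ 0 + (\<Sum>j<p. \<mu> j)"
  define h where "h j u = b j u - \<mu> j" for j u
  define Q where "Q = m\<^sup>2 + (\<Sum>j<p. (\<Sum>u=1..q j. (h j u)\<^sup>2) / real (q j))"
  have "c \<bullet> ((transpose_mat Zs * Zs) *\<^sub>v c) = (Zs *\<^sub>v c) \<bullet> (Zs *\<^sub>v c)"
  proof -
    have "(transpose_mat Zs * Zs) *\<^sub>v c = transpose_mat Zs *\<^sub>v (Zs *\<^sub>v c)"
      using Zs c by (intro assoc_mult_mat_vec) auto
    thus ?thesis
      using transpose_vec_mult_scalar[OF Zs c, of "Zs *\<^sub>v c"] Zs c
      by (subst comm_scalar_prod[of _ ?D]) auto
  qed
  also have "\<dots> = (\<Sum>i<n. (row Zs i \<bullet> c)\<^sup>2)"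
    using Zs by (simp add: scalar_prod_def[of "Zs *\<^sub>v c"] power2_eq_square atLeast0LessThan)
  also have "\<dots> = (\<Sum>i<n. (m + (\<Sum>j<p. h j (Xs $$ (i, j))))\<^sup>2)"
  proof (intro sum.cong refl)
    fix i assume "i \<in> {..<n}"
    hence i: "i < n" by simp
    have "row Zs i \<bullet> c = c $ 0 + (\<Sum>j<p. b j (row Xs i $ j))"
      unfolding row_Zs[OF i] using Xs i levels by (intro b(3)) auto
    also have "\<dots> = m + (\<Sum>j<p. h j (Xs $$ (i, j)))"
      using Xs i by (simp add: m_def h_def sum_subtractf)
    finally show "(row Zs i \<bullet> c)\<^sup>2 = (m + (\<Sum>j<p. h j (Xs $$ (i, j))))\<^sup>2" by simp
  qed
  finally have form: "c \<bullet> ((transpose_mat Zs * Zs) *\<^sub>v c) = \<dots>" .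
  have h0: "(\<Sum>u=1..q j. h j u) = 0" if "j < p" for j
    using q[OF that] by (simp add: h_def \<mu>_def sum_subtractf)
  have energy: "real n * (1 - imbalance q Xs) * Q \<le> c \<bullet> ((transpose_mat Zs * Zs) *\<^sub>v c)"
    using additive_model_energy_ge[where x = "\<lambda>i j. Xs $$ (i, j)" and h = h and m = m, OF n q levels h0]
      Xs unfolding form Q_def imbalance_def level_count_def pair_count_def Let_def by simp
  have norm: "c \<bullet> c \<le> K * Q"
    using dummy_coefficients_le_energy[where c = "c $ 0" and b = b, OF q b(1)]
    unfolding b(2) K_def Q_def m_def h_def \<mu>_def by simp
  have K: "K > 0"
    unfolding K_def by (intro add_pos_nonneg zero_less_power mult_nonneg_nonneg sum_nonneg) auto
  have cc: "c \<bullet> c \<ge> 0"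
    unfolding b(2) by (intro add_nonneg_nonneg sum_nonneg) auto
  \<comment> \<open>Passing from \<open>Q\<close> to \<open>(c \<bullet> c) / K\<close> preserves
    the lower bound only when the factor \<open>1 - imbalance q Xs\<close> is nonnegative, hence the
    case split.\<close>
  show ?thesis
  proof (cases "imbalance q Xs < 1")
    case True
    have "real n * (1 / K) * (1 - imbalance q Xs) * (c \<bullet> c) = real n * (1 - imbalance q Xs) * ((c \<bullet> c) / K)"
      by simp
    also have "\<dots> \<le> real n * (1 - imbalance q Xs) * Q"
      using True norm K by (intro mult_left_mono) (auto simp: divide_le_eq mult.commute)
    finally show ?thesis
      using energy by (simp add: n_def Xs_def)
  next
    case False
    have "real n * (1 / K) * (1 - imbalance q Xs) * (c \<bullet> c) \<le> 0"
      using False K cc by (intro mult_nonpos_nonneg mult_nonneg_nonpos) auto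
    also have "\<dots> \<le> c \<bullet> ((transpose_mat Zs * Zs) *\<^sub>v c)"
      unfolding form by (simp add: sum_nonneg)
    finally show ?thesis
      by (simp add: n_def Xs_def)
  qed
qed

theorem theorem1:
  fixes p :: nat and q :: "nat \<Rightarrow> nat"
  assumes "p \<ge> 1"
    and "\<And>j. j < p \<Longrightarrow> q j \<ge> 1"
  shows "\<exists>\<nu>::real. \<nu> > 0 \<and>
    (\<forall>N n X Z idx Xs Zs Ms.
      X \<in> carrier_mat N p \<longrightarrow> categorical_data q X \<longrightarrow>
      Z = dummy_coding q X \<longrightarrow> invertible_mat (transpose_mat Z * Z) \<longrightarrow>
      n \<ge> 1 \<longrightarrow> subsample_indices N n idx \<longrightarrow>
      Xs = select_rows X idx \<longrightarrow> Zs = select_rows Z idx \<longrightarrow> Ms = transpose_mat Zs * Zs \<longrightarrow>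
        lambda_min Ms \<ge> real n * \<nu> * (1 - imbalance q Xs) \<and>
        (imbalance q Xs < 1 \<longrightarrow> invertible_mat Ms))"
proof -
  \<comment> \<open>This is the reciprocal of the constant comparing coefficients with
    \<open>Q\<close>, fixed before any data matrix or subsample is chosen.\<close>
  define \<nu> where "\<nu> = 1 / ((1 + (\<Sum>j<p. real (q j)))\<^sup>2 + 4 * (\<Sum>j<p. real (q j) ^ 3))"
  have \<nu>: "\<nu> > 0"
    unfolding \<nu>_def
    by (intro divide_pos_pos add_pos_nonneg zero_less_power mult_nonneg_nonneg sum_nonneg) auto
  show ?thesis
  proof (intro exI[of _ \<nu>] conjI[OF \<nu>] allI impI)
    fix N n X Z idx Xs Zs Ms
    assume X: "X \<in> carrier_mat N p" "categorical_data q X" and Z: "Z = dummy_coding q X"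
      and n: "n \<ge> 1" "subsample_indices N n idx"
      and Xs: "Xs = select_rows X idx" and Zs: "Zs = select_rows Z idx" and Ms: "Ms = transpose_mat Zs * Zs"
    let ?D = "1 + length (dummy_labels p q)"
    have idx: "length idx = n" "set idx \<subseteq> {..<N}" "idx \<noteq> []"
      using n by (auto simp: subsample_indices_def)
    have Zs_carrier: "Zs \<in> carrier_mat n ?D"
      using X(1) idx(1) unfolding carrier_mat_def Zs Z by (simp add: select_rows_def dummy_coding_def)
    have Ms_carrier: "Ms \<in> carrier_mat ?D ?D"
      using Zs_carrier by (simp add: Ms)
    have sym: "transpose_mat Ms = Ms"
      using Zs_carrier by (simp add: Ms transpose_mult[of _ ?D n])
    have ge: "real n * \<nu> * (1 - imbalance q Xs) * (v \<bullet> v) \<le> v \<bullet> (Ms *\<^sub>v v)" if "v \<in> carrier_vec ?D" for v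
      using information_matrix_form_ge[OF X assms(2) idx(2,3) that] unfolding \<nu>_def Ms Zs Z Xs idx(1) .
    show "lambda_min Ms \<ge> real n * \<nu> * (1 - imbalance q Xs) \<and> (imbalance q Xs < 1 \<longrightarrow> invertible_mat Ms)"
    proof (intro conjI impI)
      show "lambda_min Ms \<ge> real n * \<nu> * (1 - imbalance q Xs)"
        using Ms_carrier sym ge by (intro lambda_min_ge) auto
      assume f: "imbalance q Xs < 1"
      show "invertible_mat Ms"
      \<comment> \<open>A nonzero kernel vector would make the quadratic form 0, whereas its lower
        bound is strictly positive when \<open>imbalance q Xs < 1\<close>.\<close>
      proof (rule invertible_mat_if_trivial_kernel[OF Ms_carrier], rule ccontr)
        fix v assume v: "v \<in> carrier_vec ?D" "Ms *\<^sub>v v = 0\<^sub>v ?D" "v \<noteq> 0\<^sub>v ?D"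
        have "0 < real n * \<nu> * (1 - imbalance q Xs) * (v \<bullet> v)"
          using n(1) \<nu> f real_scalar_prod_self_pos[OF v(1,3)] by simp
        also have "\<dots> \<le> v \<bullet> (Ms *\<^sub>v v)"
          by (rule ge[OF v(1)])
        also have "\<dots> = 0"
          unfolding v(2) using v(1) by simp
        finally show False by simp
      qed
    qed
  qed
qed

end
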